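(* Let $n > t \ge 0$ and $m \ge 1$ be integers and let $X$ be a nonempty set. Suppose $a_1,\dots,a_m,b_1,\dots,b_m \in X^n$ are such that for each $i \in [m]$, $\mathrm{dist}(a_i,b_i) = t + s_i$ for some integer $s_i \ge 1$, and $\mathrm{dist}(a_i,b_j) \le t$ for all distinct $i,j \in [m]$. Then $$\sum_{i=1}^m \frac{V_{t+s_i,s_i}}{2^{t+s_i}} \le 1.$$ In particular, $f(t;X) \le 2^{t+1}$, and if $s \ge 1$ is such that $s_i \ge s$ for all $i \in [m]$, then $m \le 2^{t+s}/V_{t+s,s}$; consequently $f(t,s;X) \le 2^{t+s}/V_{t+s,s}$.
   Context: For $p,q \in X^n$, $\mathrm{dist}(p,q)$ is the Hamming distance (number of coordinates in which they differ). For integers $1 \le d \le n$, $V_{n,d} = \sum_{i=0}^{(d-1)/2} \binom{n}{i}$ if $d$ is odd, and $V_{n,d} = \sum_{i=0}^{d/2-1} \binom{n}{i} + \binom{n-1}{d/2-1}$ if $d$ is even. $f(t;X)$ is the maximum $m$ such that there exist $n > t$ and $a_1,\dots,a_m,b_1,\dots,b_m \in X^n$ with $\mathrm{dist}(a_i,b_i) \ge t+1$ for all $i$ and $\mathrm{dist}(a_i,b_j) \le t$ for all distinct $i,j$. For $s \ge 1$, $f(t,s;X)$ is the maximum $m$ such that there exist $n > t$ and $a_1,\dots,a_m,b_1,\dots,b_m \in X^n$ with $\mathrm{dist}(a_i,b_i) \ge t+s$ for all $i$ and $\mathrm{dist}(a_i,b_j) \le t$ for all distinct $i,j$. *)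

theory Defs
  imports Complex_Main "HOL-Library.FuncSet"
begin

text \<open>The points of \<open>X\<^sup>n\<close> are the extensional functions \<open>{1..n} \<rightarrow>\<^sub>E X\<close>.\<close>

definition hamming_dist :: "nat \<Rightarrow> (nat \<Rightarrow> 'a) \<Rightarrow> (nat \<Rightarrow> 'a) \<Rightarrow> nat" where
  "hamming_dist n p q = card {k \<in> {1..n}. p k \<noteq> q k}"

text \<open>Meant for \<open>1 \<le> d \<le> n\<close>, where no division or subtraction below truncates.\<close>

definition V :: "nat \<Rightarrow> nat \<Rightarrow> nat" where
  "V n d = (if odd d then (\<Sum>i = 0..(d - 1) div 2. n choose i)
            else (\<Sum>i = 0..d div 2 - 1. n choose i) + ((n - 1) choose (d div 2 - 1)))"

definition sizes :: "nat \<Rightarrow> 'a set \<Rightarrow> nat set" where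
  "sizes t X = {m. \<exists>n>t. \<exists>a b.
     (\<forall>i\<in>{1..m}. a i \<in> {1..n} \<rightarrow>\<^sub>E X \<and> b i \<in> {1..n} \<rightarrow>\<^sub>E X) \<and>
     (\<forall>i\<in>{1..m}. t + 1 \<le> hamming_dist n (a i) (b i)) \<and>
     (\<forall>i\<in>{1..m}. \<forall>j\<in>{1..m}. i \<noteq> j \<longrightarrow> hamming_dist n (a i) (b j) \<le> t)}"

definition sizes_gap :: "nat \<Rightarrow> nat \<Rightarrow> 'a set \<Rightarrow> nat set" where
  "sizes_gap t s X = {m. \<exists>n>t. \<exists>a b.
     (\<forall>i\<in>{1..m}. a i \<in> {1..n} \<rightarrow>\<^sub>E X \<and> b i \<in> {1..n} \<rightarrow>\<^sub>E X) \<and>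
     (\<forall>i\<in>{1..m}. t + s \<le> hamming_dist n (a i) (b i)) \<and>
     (\<forall>i\<in>{1..m}. \<forall>j\<in>{1..m}. i \<noteq> j \<longrightarrow> hamming_dist n (a i) (b j) \<le> t)}"

text \<open>
  The empty family (\<open>m = 0\<close>) is admitted, so that the maxima below also make sense when
  \<open>X\<close> is a singleton. As \<open>Max\<close> is unspecified on infinite sets, a bound on \<open>f\<close> or \<open>f_gap\<close>
  is meaningful only together with the finiteness of the set of sizes.
\<close>

lemma zero_in_sizes: "0 \<in> sizes t X" "0 \<in> sizes_gap t s X"
  by (auto simp: sizes_def sizes_gap_def)

definition f :: "nat \<Rightarrow> 'a set \<Rightarrow> nat" where
  "f t X = Max (sizes t X)"

definition f_gap :: "nat \<Rightarrow> nat \<Rightarrow> 'a set \<Rightarrow> nat" where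
  "f_gap t s X = Max (sizes_gap t s X)"

end

theory Submission
  imports Defs
begin

text \<open>
  Replace \<open>X\<close> by a finite set of reals, put \<open>N = {1..n}\<close>, and let \<open>E\<^sub>i\<close> be the set of coordinates
  where \<open>a\<^sub>i\<close> and \<open>b\<^sub>i\<close> differ, without its largest element \<open>k\<^sub>i\<close> if \<open>s\<^sub>i\<close> is even; thus
  \<open>card E\<^sub>i = t + 2 r\<^sub>i + 1\<close> with \<open>r\<^sub>i = (s\<^sub>i - 1) div 2\<close>. For \<open>S \<subseteq> N - E\<^sub>i\<close> and \<open>T \<subseteq> E\<^sub>i\<close> with
  \<open>card T \<le> r\<^sub>i\<close>, consider the multilinear polynomial
  \<open>(\<Prod>k\<in>E\<^sub>i-T. x\<^sub>k - b\<^sub>i k) * (\<Prod>k\<in>T\<union>S. x\<^sub>k - a\<^sub>i k)\<close> and the functional on multilinear polynomials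
  that takes the coefficient of \<open>x\<^sub>k\<close> for \<open>k \<in> S \<union> T\<close> and substitutes \<open>x\<^sub>k = a\<^sub>i k\<close> elsewhere.
  If the polynomial of \<open>(i, S, T)\<close> does not vanish under the functional of \<open>(j, S', T')\<close>, where
  \<open>i \<noteq> j\<close>, then \<open>S' \<union> T' \<subseteq> E\<^sub>i \<union> S\<close>, and \<open>a\<^sub>j\<close> differs from \<open>b\<^sub>i\<close> on the rest of \<open>E\<^sub>i \<union> S\<close> outside
  \<open>T \<union> {k\<^sub>i}\<close>. As \<open>dist(a\<^sub>j, b\<^sub>i) \<le> t\<close>, counting gives \<open>card S + r\<^sub>i \<le> card S' + r\<^sub>j\<close>, with equality
  only if \<open>k\<^sub>i \<in> S - S'\<close>, which a lexicographic comparison of \<open>S\<close> and \<open>S'\<close> detects. Hence the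
  pairing is triangular, so the number \<open>\<Sum>\<^sub>i 2\<^sup>n V(t + s\<^sub>i, s\<^sub>i) / 2^(t + s\<^sub>i)\<close> of triples is at most the
  dimension \<open>2\<^sup>n\<close> of the space of multilinear polynomials.
\<close>

section \<open>Linear algebra: dimension bounds from triangular pairings\<close>

lemma exists_nontrivial_relation:
  fixes u :: "'p \<Rightarrow> 'z \<Rightarrow> 'f::field"
  assumes "finite Z" "finite I" "card Z < card I"
  shows "\<exists>c. (\<exists>p\<in>I. c p \<noteq> 0) \<and> (\<forall>z\<in>Z. (\<Sum>p\<in>I. c p * u p z) = 0)"
  using assms
proof (induction Z arbitrary: I u rule: finite_induct)
  case empty
  then have "I \<noteq> {}" by auto
  then show ?case by (intro exI[of _ "\<lambda>_. 1"]) auto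
next
  case (insert y Z)
  show ?case
  proof (cases "\<forall>p\<in>I. u p y = 0")
    case True
    obtain c where "\<exists>p\<in>I. c p \<noteq> 0" "\<forall>z\<in>Z. (\<Sum>p\<in>I. c p * u p z) = 0"
      using insert.IH[of I u] insert.prems insert.hyps by auto
    with True show ?thesis by (intro exI[of _ c]) auto
  next
    case False
    then obtain q where q: "q \<in> I" "u q y \<noteq> 0" by auto
    let ?I = "I - {q}"
    \<comment> \<open>Eliminate coordinate \<open>y\<close> with pivot \<open>q\<close>;
      \<open>?cq\<close> collects the subtracted multiples of \<open>u q\<close>.\<close>
    let ?u = "\<lambda>p z. u p z - u p y / u q y * u q z"
    have "card Z < card ?I"
      using insert.prems insert.hyps q by simp
    then obtain c where c: "\<exists>p\<in>?I. c p \<noteq> 0" "\<forall>z\<in>Z. (\<Sum>p\<in>?I. c p * ?u p z) = 0"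
      using insert.IH[of ?I ?u] insert.prems by auto
    let ?cq = "- (\<Sum>p\<in>?I. c p * (u p y / u q y))"
    let ?c = "c(q := ?cq)"
    have expand: "(\<Sum>p\<in>I. ?c p * u p z) = (\<Sum>p\<in>?I. c p * ?u p z)" for z
    proof -
      have "(\<Sum>p\<in>I. ?c p * u p z) = ?cq * u q z + (\<Sum>p\<in>?I. ?c p * u p z)"
        using insert.prems q by (subst sum.remove[of _ q]) auto
      also have "(\<Sum>p\<in>?I. ?c p * u p z) = (\<Sum>p\<in>?I. c p * u p z)"
        by (intro sum.cong) auto
      finally show ?thesis
        by (simp add: sum_subtractf right_diff_distrib sum_distrib_right mult.assoc)
    qed
    have "(\<Sum>p\<in>?I. c p * ?u p y) = 0"
      using q by (intro sum.neutral) auto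
    then have "\<forall>z\<in>insert y Z. (\<Sum>p\<in>I. ?c p * u p z) = 0"
      unfolding expand using c(2) by auto
    moreover have "\<exists>p\<in>I. ?c p \<noteq> 0"
      using c(1) by auto
    ultimately show ?thesis by blast
  qed
qed

text \<open>More than \<open>card Z\<close> vectors are linearly dependent; pairing a relation with
  \<open>v q\<close>, for an \<open>R\<close>-minimal \<open>q\<close> in its support, leaves only
  the nonzero diagonal term.\<close>

lemma card_le_of_triangular_pairing:
  fixes u v :: "'p \<Rightarrow> 'z \<Rightarrow> 'f::field"
  assumes fin: "finite I" "finite Z" and wf: "wf R"
    and diag: "\<And>p. p \<in> I \<Longrightarrow> (\<Sum>z\<in>Z. u p z * v p z) \<noteq> 0"
    and tri: "\<And>p q. p \<in> I \<Longrightarrow> q \<in> I \<Longrightarrow> p \<noteq> q \<Longrightarrow>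
      (\<Sum>z\<in>Z. u p z * v q z) \<noteq> 0 \<Longrightarrow> (p, q) \<in> R"
  shows "card I \<le> card Z"
proof (rule ccontr)
  assume "\<not> card I \<le> card Z"
  then obtain c p where p: "p \<in> I" "c p \<noteq> 0"
    and c: "\<forall>z\<in>Z. (\<Sum>p\<in>I. c p * u p z) = 0"
    using exists_nontrivial_relation[of Z I u] fin by (auto simp: not_le)
  obtain q where q: "q \<in> {p \<in> I. c p \<noteq> 0}"
    and min: "\<And>p. (p, q) \<in> R \<Longrightarrow> p \<notin> {p \<in> I. c p \<noteq> 0}"
    using wfE_min[OF wf, of p "{p \<in> I. c p \<noteq> 0}"] p by blast
  have "0 = (\<Sum>z\<in>Z. (\<Sum>p\<in>I. c p * u p z) * v q z)"
    using c by simp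
  also have "\<dots> = (\<Sum>p\<in>I. c p * (\<Sum>z\<in>Z. u p z * v q z))"
    unfolding sum_distrib_left sum_distrib_right
    by (subst sum.swap) (simp add: mult.assoc)
  also have "\<dots> = (\<Sum>p\<in>{q}. c p * (\<Sum>z\<in>Z. u p z * v q z))"
  proof (rule sum.mono_neutral_right)
    show "\<forall>p\<in>I - {q}. c p * (\<Sum>z\<in>Z. u p z * v q z) = 0"
      using min tri[of _ q] q by fastforce
  qed (use fin q in auto)
  finally show False
    using diag[of q] q by simp
qed

text \<open>
  The pair \<open>(\<alpha> p k, \<beta> p k)\<close> stands for the linear factor \<open>\<alpha> p k * x\<^sub>k + \<beta> p k\<close>, and
  \<open>(\<gamma> q k, \<delta> q k)\<close> for a functional on such factors: \<open>(c, 1)\<close> substitutes \<open>c\<close> for \<open>x\<^sub>k\<close>, and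
  \<open>(1, 0)\<close> takes the coefficient of \<open>x\<^sub>k\<close>.
\<close>

lemma card_le_of_triangular_tensors:
  fixes \<alpha> \<beta> \<gamma> \<delta> :: "'p \<Rightarrow> 'k \<Rightarrow> 'f::field"
  assumes fin: "finite I" "finite N" and wf: "wf R"
    and diag: "\<And>p k. p \<in> I \<Longrightarrow> k \<in> N \<Longrightarrow> \<alpha> p k * \<gamma> p k + \<beta> p k * \<delta> p k \<noteq> 0"
    and tri: "\<And>p q. p \<in> I \<Longrightarrow> q \<in> I \<Longrightarrow> p \<noteq> q \<Longrightarrow>
      (\<And>k. k \<in> N \<Longrightarrow> \<alpha> p k * \<gamma> q k + \<beta> p k * \<delta> q k \<noteq> 0) \<Longrightarrow> (p, q) \<in> R"
  shows "card I \<le> 2 ^ card N"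
proof -
  \<comment> \<open>\<open>?u p Z\<close> is the coefficient of the monomial with variables indexed
    by \<open>Z\<close>, so expanding a product of sums factors the pairing over
    \<open>N\<close>.\<close>
  let ?u = "\<lambda>p Z. prod (\<alpha> p) Z * prod (\<beta> p) (N - Z)"
  let ?v = "\<lambda>p Z. prod (\<gamma> p) Z * prod (\<delta> p) (N - Z)"
  have pairing: "(\<Sum>Z\<in>Pow N. ?u p Z * ?v q Z) = (\<Prod>k\<in>N. \<alpha> p k * \<gamma> q k + \<beta> p k * \<delta> q k)" for p q
    by (simp add: prod_add[OF fin(2)] prod.distrib ac_simps)
  have "card I \<le> card (Pow N)"
  proof (rule card_le_of_triangular_pairing[OF fin(1) _ wf, where u = ?u and v = ?v])
    show "(\<Sum>Z\<in>Pow N. ?u p Z * ?v p Z) \<noteq> 0" if "p \<in> I" for p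
      unfolding pairing using diag that fin by simp
    show "(p, q) \<in> R" if "p \<in> I" "q \<in> I" "p \<noteq> q" "(\<Sum>Z\<in>Pow N. ?u p Z * ?v q Z) \<noteq> 0" for p q
      using that tri[of p q] fin unfolding pairing by simp
  qed (use fin in auto)
  then show ?thesis by (simp add: card_Pow fin)
qed

section \<open>Combinatorics of the index triples\<close>

text \<open>Sets are compared from the top as binary numbers: \<open>2 ^ k\<close> outweighs all
  smaller powers together.\<close>

lemma sum_power2_less:
  fixes A B :: "nat set"
  assumes "finite B" "k \<in> B" "k \<notin> A" "A \<inter> {k<..} \<subseteq> B"
  shows "sum ((^) 2) A < (sum ((^) 2) B :: nat)"
proof -
  let ?A = "A \<inter> {k<..}"
  have fin: "finite ?A" using assms finite_subset by blast
  have "A \<subseteq> {..<k} \<union> ?A" using assms(3) by (auto simp: not_less le_less)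
  then have "sum ((^) 2) A \<le> (sum ((^) 2) ({..<k} \<union> ?A) :: nat)"
    using fin by (intro sum_mono2) auto
  also have "\<dots> = sum ((^) 2) {..<k} + sum ((^) 2) ?A"
    using fin by (intro sum.union_disjoint) auto
  also have "sum ((^) 2) {..<k} < (2 ^ k :: nat)"
    using sum_power2[of k] by (simp add: atLeast0LessThan)
  also have "2 ^ k + sum ((^) 2) ?A = (sum ((^) 2) (insert k ?A) :: nat)"
    using fin by simp
  also have "\<dots> \<le> sum ((^) 2) B"
    using assms by (intro sum_mono2) auto
  finally show ?thesis by simp
qed

lemma card_bounded_subsets:
  assumes "finite A"
  shows "card {T. T \<subseteq> A \<and> card T \<le> r} = (\<Sum>l=0..r. card A choose l)"
proof -
  have "{T. T \<subseteq> A \<and> card T \<le> r} = (\<Union>l\<in>{0..r}. {T. T \<subseteq> A \<and> card T = l})"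
    by auto
  also have "card \<dots> = (\<Sum>l=0..r. card {T. T \<subseteq> A \<and> card T = l})"
    using assms by (intro card_UN_disjoint) auto
  finally show ?thesis by (simp add: n_subsets assms)
qed

text \<open>
  The set \<open>K i\<close> is the coordinate given up when \<open>s i\<close> is even: it is treated as if \<open>a i\<close> and
  \<open>b i\<close> agreed there.
\<close>

lemma cross_distance_count:
  fixes a b :: "'i \<Rightarrow> nat \<Rightarrow> 'f::field"
  assumes finJ: "finite J" and finN: "finite N"
    and E: "\<And>i. i \<in> J \<Longrightarrow> E i \<subseteq> N" "\<And>i. i \<in> J \<Longrightarrow> card (E i) = t + 2 * r i + 1"
      "\<And>i k. i \<in> J \<Longrightarrow> k \<in> E i \<Longrightarrow> a i k \<noteq> b i k"
    and K: "\<And>i. i \<in> J \<Longrightarrow> card (K i) \<le> 1"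
      "\<And>i k. i \<in> J \<Longrightarrow> k \<in> K i \<Longrightarrow> k \<in> N \<and> E i \<subseteq> {..<k}"
    and eq: "\<And>i k. i \<in> J \<Longrightarrow> k \<in> N - E i - K i \<Longrightarrow> a i k = b i k"
    and cross: "\<And>i j. i \<in> J \<Longrightarrow> j \<in> J \<Longrightarrow> i \<noteq> j \<Longrightarrow> card {k\<in>N. a j k \<noteq> b i k} \<le> t"
  shows "(\<Sum>i\<in>J. 2 ^ (card N - (t + 2 * r i + 1)) * (\<Sum>l=0..r i. (t + 2 * r i + 1) choose l))
    \<le> 2 ^ card N"
proof -
  define I where "I = Sigma J (\<lambda>i. Pow (N - E i) \<times> {T. T \<subseteq> E i \<and> card T \<le> r i})"
  define \<alpha> where "\<alpha> = (\<lambda>(i, S, T :: nat set) k. if k \<in> E i \<union> S then 1 else 0 :: 'f)"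
  define \<beta> where "\<beta> = (\<lambda>(i, S, T) k.
    if k \<in> E i - T then - b i k else if k \<in> T \<union> S then - a i k else 1)"
  define \<gamma> where "\<gamma> = (\<lambda>(i :: 'i, S, T) k. if k \<in> S \<union> T then 1 else a i k)"
  define \<delta> where "\<delta> = (\<lambda>(i :: 'i, S :: nat set, T) k. if k \<in> S \<union> T then 0 else 1 :: 'f)"
  define \<rho> where "\<rho> = (\<lambda>(i, S, T :: nat set).
    (card S + r i, sum ((^) 2) (N - S) :: nat, card T))"
  define R where "R = inv_image (less_than <*lex*> less_than <*lex*> less_than) \<rho>"
  have finE: "finite (E i)" if "i \<in> J" for i
    using E(1)[OF that] finN finite_subset by blast
  have finI: "finite I"
    unfolding I_def using finJ finN finE by (intro finite_SigmaI) auto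
  have "card I \<le> 2 ^ card N"
  proof (rule card_le_of_triangular_tensors[OF finI finN, of R \<alpha> \<gamma> \<beta> \<delta>])
    show "wf R" unfolding R_def by (intro wf_inv_image wf_lex_prod wf_less_than)
  next
    fix p k
    assume "p \<in> I" "k \<in> N"
    then show "\<alpha> p k * \<gamma> p k + \<beta> p k * \<delta> p k \<noteq> 0"
      using E(3) by (cases p) (auto simp: I_def \<alpha>_def \<beta>_def \<gamma>_def \<delta>_def)
  next
    fix p q
    assume pq: "p \<in> I" "q \<in> I" "p \<noteq> q"
      and nz: "\<And>k. k \<in> N \<Longrightarrow> \<alpha> p k * \<gamma> q k + \<beta> p k * \<delta> q k \<noteq> 0"
    obtain i S T where p: "p = (i, S, T)" by (cases p) auto
    obtain j S' T' where q: "q = (j, S', T')" by (cases q) auto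
    have i: "i \<in> J" "S \<subseteq> N - E i" "T \<subseteq> E i" "card T \<le> r i"
      and j: "j \<in> J" "S' \<subseteq> N - E j" "T' \<subseteq> E j" "card T' \<le> r j"
      using pq unfolding p q I_def by auto
    note fin = finE[OF i(1)] finE[OF j(1)] finite_subset[OF i(2)] finite_subset[OF i(3)]
      finite_subset[OF j(2)] finite_subset[OF j(3)]
    \<comment> \<open>Taking a coefficient kills the constant factor 1, and substituting
      \<open>a j k\<close> kills a factor with that root; nonvanishing excludes both.\<close>
    have lead: "k \<in> E i \<union> S" if "k \<in> S' \<union> T'" for k
      using nz[of k] that i(2) j(2,3) E(1)[OF j(1)]
      by (auto simp: p q \<alpha>_def \<beta>_def \<gamma>_def \<delta>_def split: if_splits)
    have evb: "a j k \<noteq> b i k" if "k \<in> E i - T" "k \<notin> S' \<union> T'" for k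
      using nz[of k] that E(1)[OF i(1)]
      by (auto simp: p q \<alpha>_def \<beta>_def \<gamma>_def \<delta>_def split: if_splits)
    have eva: "a j k \<noteq> a i k" if "k \<in> T \<union> S" "k \<notin> S' \<union> T'" for k
    proof -
      have "k \<in> N" "k \<in> E i \<union> S" "k \<notin> E i - T"
        using that E(1)[OF i(1)] i(2,3) by auto
      then show ?thesis
        using nz[of k] that by (auto simp: p q \<alpha>_def \<beta>_def \<gamma>_def \<delta>_def)
    qed
    show "(p, q) \<in> R"
    proof (cases "i = j")
      case True
      have "S = S'" using lead eva i j True by blast
      moreover have "T \<subseteq> T'" using eva i j True by blast
      ultimately have "T \<subset> T'" using pq True p q by auto
      then have "card T < card T'"
        using fin j by (intro psubset_card_mono) auto
      with True \<open>S = S'\<close> show ?thesis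
        by (simp add: R_def \<rho>_def p q)
    next
      case False
      let ?X = "(E i \<union> S) - (S' \<union> T')"
      \<comment> \<open>On \<open>S\<close> the root is \<open>a i k\<close>, which is known to
        equal \<open>b i k\<close> only off \<open>K i\<close>; this coordinate is left out of the
        count.\<close>
      let ?\<kappa> = "K i \<inter> S - (S' \<union> T')"
      have finK: "finite ?\<kappa>" using fin i finN by auto
      have "?X - T - ?\<kappa> \<subseteq> {k\<in>N. a j k \<noteq> b i k}"
      proof
        fix k assume k: "k \<in> ?X - T - ?\<kappa>"
        then have N: "k \<in> N" using i E(1) by blast
        moreover have "a j k \<noteq> b i k"
        proof (cases "k \<in> E i")
          case True then show ?thesis using evb k by auto
        next
          case False
          then show ?thesis using eva[of k] eq[of i k] k N i(1) by auto
        qed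
        ultimately show "k \<in> {k\<in>N. a j k \<noteq> b i k}" by simp
      qed
      then have "card (?X - T - ?\<kappa>) \<le> card {k\<in>N. a j k \<noteq> b i k}"
        using finN by (intro card_mono) auto
      then have le: "card (?X - T - ?\<kappa>) \<le> t"
        using cross[OF i(1) j(1) False] by linarith
      have "card (?X - T - ?\<kappa>) \<ge> card ?X - card T - card ?\<kappa>"
        using diff_card_le_card_Diff[of T ?X] diff_card_le_card_Diff[of ?\<kappa> "?X - T"] finK fin i finN
        by fastforce
      moreover have "card ?X = card (E i \<union> S) - card (S' \<union> T')"
        using lead fin finN by (intro card_Diff_subset) (auto intro: finite_subset j)
      moreover have "card (E i \<union> S) = t + 2 * r i + 1 + card S"
        using fin i finN E(2) by (subst card_Un_disjoint) auto
      moreover have "card (S' \<union> T') \<le> card S' + card T'"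
        by (rule card_Un_le)
      \<comment> \<open>\<open>T\<close> and \<open>T'\<close> cost at most \<open>r i\<close> and
        \<open>r j\<close>; the remaining 1 gives strict descent unless \<open>?\<kappa>\<close> is
        nonempty.\<close>
      ultimately have key: "r i + 1 + card S \<le> card S' + r j + card ?\<kappa>"
        using le i(4) j(4) by linarith
      show ?thesis
      proof (cases "?\<kappa> = {}")
        case True
        with key show ?thesis by (simp add: R_def \<rho>_def p q)
      next
        case False
        then obtain k where k: "k \<in> K i" "k \<in> S" "k \<notin> S'" by auto
        have "card ?\<kappa> \<le> card (K i)"
          using K(1)[OF i(1)] K(2)[OF i(1)] finN
          by (intro card_mono) (auto intro: finite_subset[of "K i" N])
        with K(1)[OF i(1)] key have "r i + card S \<le> card S' + r j" by linarith
        \<comment> \<open>Above \<open>k\<close> there is no point of \<open>E i\<close>, so by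
          \<open>lead\<close> points of \<open>S'\<close> there lie in \<open>S\<close>. As
          \<open>k\<close> is in \<open>S\<close> only, the complement of \<open>S\<close> is the
          smaller one.\<close>
        moreover have "sum ((^) 2) (N - S) < (sum ((^) 2) (N - S') :: nat)"
          using k K(2)[OF i(1) k(1)] finN lead
          by (intro sum_power2_less[of _ k]) fastforce+
        ultimately show ?thesis by (auto simp: R_def \<rho>_def p q)
      qed
    qed
  qed
  also have "card I = (\<Sum>i\<in>J. card (Pow (N - E i) \<times> {T. T \<subseteq> E i \<and> card T \<le> r i}))"
    unfolding I_def using finJ finN finE by (intro card_SigmaI) auto
  also have "\<dots> = (\<Sum>i\<in>J. 2 ^ (card N - (t + 2 * r i + 1)) *
      (\<Sum>l=0..r i. (t + 2 * r i + 1) choose l))"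
    using finN finE E
    by (intro sum.cong)
      (auto simp: card_cartesian_product card_Pow card_Diff_subset card_bounded_subsets)
  finally show ?thesis .
qed

section \<open>Identities and monotonicity for \<open>V\<close>\<close>

lemma V_odd: "V n (2 * r + 1) = (\<Sum>l=0..r. n choose l)"
  by (simp add: V_def)

lemma sum_choose_Suc:
  "(\<Sum>l=0..r. Suc n choose l) + (n choose r) = 2 * (\<Sum>l=0..r. n choose l)"
  by (induction r) auto

text \<open>By Pascal's rule, the weight for even \<open>s\<close> equals that for
  \<open>s - 1\<close>, which is why a coordinate can be given up.\<close>

lemma V_even: "V (Suc n) (2 * r + 2) = 2 * (\<Sum>l=0..r. n choose l)"
  using sum_choose_Suc[of n r] by (simp add: V_def)

lemma binomial_le_Suc:
  assumes "2 * r + 1 \<le> n"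
  shows "n choose r \<le> n choose Suc r"
proof -
  have "Suc r * (n choose r) \<le> (n - r) * (n choose r)"
    using assms by (intro mult_right_mono) auto
  also have "\<dots> = Suc r * (n choose Suc r)"
    using binomial_absorb_comp[of n r] binomial_absorption[of r n] by simp
  finally show ?thesis by (simp only: Suc_mult_le_cancel1)
qed

text \<open>Equality holds for odd \<open>d\<close>. For \<open>d = 2 * r + 2\<close> and
  \<open>n = Suc n'\<close> the difference is
  \<open>(n' choose Suc r) - (n' choose r)\<close>.\<close>

lemma V_Suc_Suc:
  assumes "1 \<le> d" "d \<le> n"
  shows "2 * V n d \<le> V (Suc n) (Suc d)"
proof (cases "odd d")
  case True
  then obtain r where "d = 2 * r + 1" by (elim oddE)
  then show ?thesis using V_odd[of n r] V_even[of n r] by simp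
next
  case False
  then obtain r where d: "d = 2 * r + 2"
    using assms by (metis One_nat_def Suc_1 add_Suc_right evenE mult_Suc_right not_one_le_zero
        add.commute mult_0_right nat.exhaust)
  obtain n' where n: "n = Suc n'" using assms by (cases n) auto
  have "n' choose r \<le> n' choose Suc r"
    using assms d n by (intro binomial_le_Suc) auto
  moreover have "V (Suc n) (Suc d) = (\<Sum>l=0..Suc r. Suc (Suc n') choose l)"
    using V_odd[of "Suc n" "Suc r"] d n by simp
  ultimately show ?thesis
    using V_even[of n' r] sum_choose_Suc[of "Suc n'" "Suc r"] sum_choose_Suc[of n' "Suc r"] d n
    by simp
qed

lemma V_pos: "1 \<le> d \<Longrightarrow> V n d > 0"
proof -
  have "(\<Sum>i=0..r. n choose i) > 0" for r
    by (simp add: sum_pos2[of _ 0])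
  then show ?thesis by (simp add: V_def)
qed

lemma V_ratio_mono:
  assumes "1 \<le> r" "r \<le> s"
  shows "real (V (t + r) r) / 2 ^ (t + r) \<le> real (V (t + s) s) / 2 ^ (t + s)"
  using assms(2)
proof (induction s rule: dec_induct)
  case (step s)
  have "real (V (t + s) s) / 2 ^ (t + s) = real (2 * V (t + s) s) / 2 ^ (t + Suc s)"
    by simp
  also have "\<dots> \<le> real (V (t + Suc s) (Suc s)) / 2 ^ (t + Suc s)"
    using V_Suc_Suc[of s "t + s"] step assms by (intro divide_right_mono of_nat_mono) auto
  finally show ?case using step by linarith
qed simp

section \<open>From Hamming distances to the weighted inequality\<close>

theorem hamming_weight_sum_le_1:
  fixes a b :: "'i \<Rightarrow> nat \<Rightarrow> 'a"
  assumes finJ: "finite J"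
    and s: "\<And>i. i \<in> J \<Longrightarrow> 1 \<le> s i \<and> hamming_dist n (a i) (b i) = t + s i"
    and cross: "\<And>i j. i \<in> J \<Longrightarrow> j \<in> J \<Longrightarrow> i \<noteq> j \<Longrightarrow> hamming_dist n (a i) (b j) \<le> t"
  shows "(\<Sum>i\<in>J. real (V (t + s i) (s i)) / 2 ^ (t + s i)) \<le> 1"
proof -
  let ?N = "{1..n}"
  let ?Y = "(\<Union>i\<in>J. a i ` ?N \<union> b i ` ?N)"
  have "finite ?Y" using finJ by auto
  \<comment> \<open>Only finitely many symbols occur, so they embed into a field.\<close>
  then obtain g :: "'a \<Rightarrow> nat" where "inj_on g ?Y"
    using finite_imp_inj_to_nat_seg by metis
  then have inj: "g (a i k) = g (b j k) \<longleftrightarrow> a i k = b j k"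
    if "i \<in> J" "j \<in> J" "k \<in> ?N" for i j k
    using that by (subst inj_on_eq_iff) auto
  define D where "D = (\<lambda>i. {k\<in>?N. a i k \<noteq> b i k})"
  \<comment> \<open>Removing the maximum keeps the rest of \<open>D i\<close> below it, as the
    lexicographic comparison demands.\<close>
  define K where "K = (\<lambda>i. if odd (s i) then {} else {Max (D i)})"
  define r where "r = (\<lambda>i. (s i - 1) div 2)"
  have finD: "finite (D i)" for i by (simp add: D_def)
  have cardD: "card (D i) = t + s i" if "i \<in> J" for i
    using s[OF that] by (simp add: D_def hamming_dist_def)
  have maxD: "Max (D i) \<in> D i" if "i \<in> J" for i
    using cardD[OF that] s[OF that] finD by (intro Max_in) auto
  have cardE: "card (D i - K i) = t + 2 * r i + 1" if "i \<in> J" for i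
    using s[OF that] cardD[OF that] maxD[OF that] finD
    by (auto simp: K_def r_def elim!: oddE evenE)
  have "(\<Sum>i\<in>J. 2 ^ (card ?N - (t + 2 * r i + 1)) *
      (\<Sum>l=0..r i. (t + 2 * r i + 1) choose l)) \<le> (2::nat) ^ card ?N"
  proof (rule cross_distance_count[OF finJ, of _ "\<lambda>i. D i - K i" _ _ "\<lambda>i k. real (g (a i k))"
        "\<lambda>i k. real (g (b i k))" K])
    show "k \<in> ?N \<and> D i - K i \<subseteq> {..<k}" if "i \<in> J" "k \<in> K i" for i k
      using that maxD[of i] finD[of i] by (auto simp: K_def D_def order.strict_iff_order split: if_splits)
    show "card {k \<in> ?N. real (g (a j k)) \<noteq> real (g (b i k))} \<le> t"
      if "i \<in> J" "j \<in> J" "i \<noteq> j" for i j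
    proof -
      have "{k \<in> ?N. real (g (a j k)) \<noteq> real (g (b i k))} = {k \<in> ?N. a j k \<noteq> b i k}"
        using inj that by auto
      then show ?thesis using cross[of j i] that by (simp add: hamming_dist_def)
    qed
    show "real (g (a i k)) \<noteq> real (g (b i k))" if "i \<in> J" "k \<in> D i - K i" for i k
      using that inj by (auto simp: D_def)
    show "real (g (a i k)) = real (g (b i k))" if "i \<in> J" "k \<in> ?N - (D i - K i) - K i" for i k
      using that by (auto simp: D_def)
  qed (use cardE in \<open>auto simp: D_def K_def\<close>)
  then have count: "(\<Sum>i\<in>J. 2 ^ (n - (t + 2 * r i + 1)) *
      (\<Sum>l=0..r i. (t + 2 * r i + 1) choose l)) \<le> (2::nat) ^ n" by simp
  have weight: "real (V (t + s i) (s i)) / 2 ^ (t + s i) * 2 ^ n =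
      real (2 ^ (n - (t + 2 * r i + 1)) * (\<Sum>l=0..r i. (t + 2 * r i + 1) choose l))"
    if i: "i \<in> J" for i
  proof -
    let ?c = "\<Sum>l=0..r i. (t + 2 * r i + 1) choose l"
    have "card (D i - K i) \<le> card ?N" by (intro card_mono) (auto simp: D_def)
    then have le: "t + 2 * r i + 1 \<le> n" using cardE[OF i] by simp
    have "real (V (t + s i) (s i)) / 2 ^ (t + s i) = real ?c / 2 ^ (t + 2 * r i + 1)"
    proof (cases "odd (s i)")
      case True
      then have si: "s i = 2 * r i + 1" by (auto simp: r_def elim!: oddE)
      have "V (t + s i) (s i) = ?c"
        unfolding si V_odd by (simp add: add.assoc)
      then show ?thesis by (simp add: si)
    next
      case False
      then have si: "s i = 2 * r i + 2" using s[OF i] by (auto simp: r_def elim!: evenE)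
      have "V (t + s i) (s i) = 2 * ?c"
        unfolding si using V_even[of "t + 2 * r i + 1" "r i"] by simp
      then show ?thesis by (simp add: si)
    qed
    moreover have "real c / 2 ^ d * 2 ^ n = real (2 ^ (n - d) * c)" if "d \<le> n" for c d
      using that by (auto simp: power_add dest!: le_Suc_ex)
    ultimately show ?thesis using le by (simp only:)
  qed
  have "(\<Sum>i\<in>J. real (V (t + s i) (s i)) / 2 ^ (t + s i)) * 2 ^ n =
      real (\<Sum>i\<in>J. 2 ^ (n - (t + 2 * r i + 1)) * (\<Sum>l=0..r i. (t + 2 * r i + 1) choose l))"
    unfolding sum_distrib_right of_nat_sum[of _ J] using weight by (intro sum.cong) auto
  also have "\<dots> \<le> real (2 ^ n)" using count by (rule of_nat_mono)
  finally show ?thesis by simp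
qed

text \<open>Each weight is at least the one for \<open>r\<close>, and the weights sum to at most
  1.\<close>

lemma hamming_family_size_le:
  fixes a b :: "'i \<Rightarrow> nat \<Rightarrow> 'a"
  assumes J: "finite J" and r: "1 \<le> r"
    and far: "\<And>i. i \<in> J \<Longrightarrow> t + r \<le> hamming_dist n (a i) (b i)"
    and cross: "\<And>i j. i \<in> J \<Longrightarrow> j \<in> J \<Longrightarrow> i \<noteq> j \<Longrightarrow> hamming_dist n (a i) (b j) \<le> t"
  shows "real (card J) \<le> 2 ^ (t + r) / real (V (t + r) r)"
proof -
  define s where "s = (\<lambda>i. hamming_dist n (a i) (b i) - t)"
  have s: "r \<le> s i" "hamming_dist n (a i) (b i) = t + s i" if "i \<in> J" for i
    using far[OF that] by (auto simp: s_def)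
  have "real (card J) * (real (V (t + r) r) / 2 ^ (t + r)) =
      (\<Sum>i\<in>J. real (V (t + r) r) / 2 ^ (t + r))" by simp
  also have "\<dots> \<le> (\<Sum>i\<in>J. real (V (t + s i) (s i)) / 2 ^ (t + s i))"
    using r s by (intro sum_mono V_ratio_mono) auto
  also have "\<dots> \<le> 1"
    using r s by (intro hamming_weight_sum_le_1[of J s n a b] J cross) force+
  finally show ?thesis
    using V_pos[OF r, of "t + r"] by (simp add: field_simps)
qed

section \<open>Bounds on the extremal functions\<close>

lemma sizes_gap_bound:
  assumes "1 \<le> s" "m \<in> sizes_gap t s X"
  shows "real m \<le> 2 ^ (t + s) / real (V (t + s) s)"
proof -
  obtain n a b where
    "\<forall>i\<in>{1..m}. t + s \<le> hamming_dist n (a i :: nat \<Rightarrow> 'a) (b i)"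
    "\<forall>i\<in>{1..m}. \<forall>j\<in>{1..m}. i \<noteq> j \<longrightarrow> hamming_dist n (a i) (b j) \<le> t"
    using assms(2) unfolding sizes_gap_def by blast
  then show ?thesis
    using hamming_family_size_le[of "{1..m}" s t n a b] assms(1) by simp
qed

lemma f_gap_bound:
  assumes "1 \<le> s"
  shows "finite (sizes_gap t s X)" "real (f_gap t s X) \<le> 2 ^ (t + s) / real (V (t + s) s)"
proof -
  have "m \<le> nat \<lfloor>2 ^ (t + s) / real (V (t + s) s)\<rfloor>" if "m \<in> sizes_gap t s X" for m
    using sizes_gap_bound[OF assms that] by (simp add: le_nat_floor)
  then show fin: "finite (sizes_gap t s X)"
    by (meson finite_nat_set_iff_bounded_le)
  have "Max (sizes_gap t s X) \<in> sizes_gap t s X"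
    using fin zero_in_sizes(2) by (intro Max_in) auto
  then show "real (f_gap t s X) \<le> 2 ^ (t + s) / real (V (t + s) s)"
    unfolding f_gap_def by (rule sizes_gap_bound[OF assms])
qed

theorem theorem2p3:
  fixes X :: "'a set" and t :: nat
  assumes "X \<noteq> {}"
  shows
    "(\<forall>(n::nat) (m::nat) (a :: nat \<Rightarrow> nat \<Rightarrow> 'a) (b :: nat \<Rightarrow> nat \<Rightarrow> 'a) (s :: nat \<Rightarrow> nat).
        n > t \<longrightarrow> m \<ge> 1 \<longrightarrow>
        (\<forall>i\<in>{1..m}. a i \<in> {1..n} \<rightarrow>\<^sub>E X \<and> b i \<in> {1..n} \<rightarrow>\<^sub>E X) \<longrightarrow>
        (\<forall>i\<in>{1..m}. s i \<ge> 1 \<and> hamming_dist n (a i) (b i) = t + s i) \<longrightarrow>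
        (\<forall>i\<in>{1..m}. \<forall>j\<in>{1..m}. i \<noteq> j \<longrightarrow> hamming_dist n (a i) (b j) \<le> t) \<longrightarrow>
        (\<Sum>i = 1..m. real (V (t + s i) (s i)) / 2 ^ (t + s i)) \<le> 1 \<and>
        (\<forall>r::nat. r \<ge> 1 \<longrightarrow> (\<forall>i\<in>{1..m}. s i \<ge> r) \<longrightarrow>
           real m \<le> 2 ^ (t + r) / real (V (t + r) r)))
     \<and> (finite (sizes t X) \<and> f t X \<le> 2 ^ (t + 1))
     \<and> (\<forall>s::nat. s \<ge> 1 \<longrightarrow>
          finite (sizes_gap t s X) \<and> real (f_gap t s X) \<le> 2 ^ (t + s) / real (V (t + s) s))"
proof (intro conjI allI impI)
  fix n m :: nat and a b :: "nat \<Rightarrow> nat \<Rightarrow> 'a" and s :: "nat \<Rightarrow> nat"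
  assume s: "\<forall>i\<in>{1..m}. s i \<ge> 1 \<and> hamming_dist n (a i) (b i) = t + s i"
    and cross: "\<forall>i\<in>{1..m}. \<forall>j\<in>{1..m}. i \<noteq> j \<longrightarrow> hamming_dist n (a i) (b j) \<le> t"
  show "(\<Sum>i = 1..m. real (V (t + s i) (s i)) / 2 ^ (t + s i)) \<le> 1"
    using s cross by (intro hamming_weight_sum_le_1[of _ s n a b]) auto
  fix r :: nat
  assume "r \<ge> 1" "\<forall>i\<in>{1..m}. s i \<ge> r"
  then show "real m \<le> 2 ^ (t + r) / real (V (t + r) r)"
    using s cross hamming_family_size_le[of "{1..m}" r t n a b] by simp
next
  have gap: "sizes t X = sizes_gap t 1 X"
    by (simp add: sizes_def sizes_gap_def)
  show "finite (sizes t X)"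
    unfolding gap by (rule f_gap_bound) simp
  \<comment> \<open>Here \<open>V (t + 1) 1 = 1\<close>.\<close>
  have "real (f t X) \<le> 2 ^ (t + 1)"
    using f_gap_bound(2)[of 1 t X] by (simp add: f_def f_gap_def gap V_def)
  then show "f t X \<le> 2 ^ (t + 1)"
    by (metis of_nat_le_iff of_nat_numeral of_nat_power)
next
  fix s :: nat
  assume "s \<ge> 1"
  then show "finite (sizes_gap t s X)"
    and "real (f_gap t s X) \<le> 2 ^ (t + s) / real (V (t + s) s)"
    by (rule f_gap_bound)+
qed

end
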